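(* Let $H=(V,E)$ be a 2-colorable hypergraph and let $\phi$ be an orientation of $H$. Then $H$ is $(d_\phi+1)$-choosable, i.e. for every assignment of lists $L(v)$ of colors to the vertices with $|L(v)|=d_\phi(v)+1$ for all $v\in V$, there is a proper coloring $c$ of $H$ with $c(v)\in L(v)$ for every $v\in V$.
   Context: A hypergraph is a pair $H=(V,E)$ with $V$ finite and $E\subset 2^V$. A coloring of $H$ is a map from $V$ to a set of colors; it is proper if every edge $e\in E$ contains two vertices of different colors. $H$ is 2-colorable if it has a proper coloring with 2 colors. An orientation of $H$ is a map $\phi:E\to V$ with $\phi(e)\in e$ for every $e\in E$, and $d_\phi(v)=|\phi^{-1}(v)|$ for $v\in V$. For $f:V\to\mathbb N$, $H$ is $f$-choosable if for every assignment of lists $L(v)$ with $|L(v)|=f(v)$ there is a proper coloring choosing the color of each $v$ from $L(v)$. *)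

theory Defs
  imports "HOL-Library.FuncSet"
begin

definition hypergraph :: "'a set \<Rightarrow> 'a set set \<Rightarrow> bool" where
  "hypergraph V E \<longleftrightarrow> finite V \<and> E \<subseteq> Pow V"

text \<open>
  Colorings of \<open>V\<close> and orientations of \<open>E\<close> are represented by total functions on the ambient types,
  but only their values on \<open>V\<close> and on \<open>E\<close>, respectively, are ever used.
\<close>

definition proper_coloring :: "'a set set \<Rightarrow> ('a \<Rightarrow> 'c) \<Rightarrow> bool" where
  "proper_coloring E c \<longleftrightarrow> (\<forall>e\<in>E. \<exists>x\<in>e. \<exists>y\<in>e. c x \<noteq> c y)"

definition colorable :: "nat \<Rightarrow> 'a set \<Rightarrow> 'a set set \<Rightarrow> bool" where
  "colorable k V E \<longleftrightarrow> (\<exists>c \<in> V \<rightarrow> {..<k}. proper_coloring E c)"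

definition orientation :: "'a set set \<Rightarrow> ('a set \<Rightarrow> 'a) \<Rightarrow> bool" where
  "orientation E \<phi> \<longleftrightarrow> (\<forall>e\<in>E. \<phi> e \<in> e)"

definition orient_deg :: "'a set set \<Rightarrow> ('a set \<Rightarrow> 'a) \<Rightarrow> 'a \<Rightarrow> nat" where
  "orient_deg E \<phi> v = card {e \<in> E. \<phi> e = v}"

text \<open>
  The colors in the lists range over an arbitrary type \<open>'c\<close>, which is an explicit parameter because
  a definition cannot quantify over types. Finiteness of the lists is required separately since
  \<open>card\<close> of an infinite set is \<open>0\<close>.
\<close>

definition choosable :: "'c itself \<Rightarrow> 'a set \<Rightarrow> 'a set set \<Rightarrow> ('a \<Rightarrow> nat) \<Rightarrow> bool" where
  "choosable (_ :: 'c itself) V E f \<longleftrightarrow>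
     (\<forall>L :: 'a \<Rightarrow> 'c set. (\<forall>v\<in>V. finite (L v) \<and> card (L v) = f v) \<longrightarrow>
        (\<exists>c. (\<forall>v\<in>V. c v \<in> L v) \<and> proper_coloring E c))"

end

theory Submission
  imports Defs
begin

text \<open>
  Fix a proper 2-coloring and pick in every edge \<open>e\<close> a vertex \<open>\<psi> e\<close> whose color differs from that
  of \<open>\<phi> e\<close>. The arcs from \<open>\<phi> e\<close> to \<open>\<psi> e\<close> form a bipartite digraph with out-degrees at most
  \<open>d\<^sub>\<phi>\<close>, and a proper coloring of this digraph is proper for the hypergraph. Bipartite digraphs are
  kernel-perfect, so the kernel argument of Bondy, Boppana and Siegel applies: take a color \<open>a\<close>,
  give it to a kernel of the set of vertices having \<open>a\<close> in their lists, and delete the kernel.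
  Every other vertex that loses the color \<open>a\<close> also loses an out-neighbor.
\<close>

text \<open>If some \<open>v\<close> has no out-neighbor in \<open>W\<close>, it joins the kernel,
  its in-neighbors are dominated by it, and induction handles the rest. Otherwise every vertex has
  an out-neighbor in \<open>W\<close>, necessarily on the opposite side, so one whole side of
  \<open>W\<close> is a kernel.\<close>

lemma bipartite_kernel_exists:
  fixes side :: "'a \<Rightarrow> bool"
  assumes "finite W" and "\<And>v u. u \<in> N v \<Longrightarrow> side u \<noteq> side v"
  shows "\<exists>K\<subseteq>W. (\<forall>v\<in>K. N v \<inter> K = {}) \<and> (\<forall>v\<in>W - K. N v \<inter> K \<noteq> {})"
  using assms(1)
proof (induction W rule: finite_psubset_induct)
  case (psubset W)
  show ?case
  proof (cases "\<exists>v\<in>W. N v \<inter> W = {}")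
    case True
    then obtain v where v: "v \<in> W" "N v \<inter> W = {}" by blast
    define W' where "W' = W - {v} - {u. v \<in> N u}"
    have "W' \<subset> W" using v by (auto simp: W'_def)
    from psubset.IH[OF this] obtain K where K: "K \<subseteq> W'" "\<forall>u\<in>K. N u \<inter> K = {}"
      "\<forall>u\<in>W' - K. N u \<inter> K \<noteq> {}" by blast
    have "insert v K \<subseteq> W" "\<forall>u\<in>insert v K. N u \<inter> insert v K = {}"
      using K(1,2) v by (auto simp: W'_def)
    moreover have "\<forall>u\<in>W - insert v K. N u \<inter> insert v K \<noteq> {}"
      using K(3) by (auto simp: W'_def)
    ultimately show ?thesis by (intro exI[of _ "insert v K"]) simp
  next
    case False
    let ?K = "{v \<in> W. side v}"
    have "?K \<subseteq> W" "\<forall>v\<in>?K. N v \<inter> ?K = {}"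
      by (auto dest: assms(2))
    moreover have "\<forall>v\<in>W - ?K. N v \<inter> ?K \<noteq> {}"
    proof
      fix v assume v: "v \<in> W - ?K"
      with False obtain u where "u \<in> N v" "u \<in> W" by blast
      with assms(2)[of u v] v show "N v \<inter> ?K \<noteq> {}" by auto
    qed
    ultimately show ?thesis by (intro exI[of _ ?K]) simp
  qed
qed

text \<open>Out-degrees are counted inside \<open>V\<close>, so that they drop when a kernel is
  deleted; \<open>L\<close> varies in the induction because the lists lose a color.\<close>

lemma bipartite_digraph_list_coloring:
  fixes side :: "'a \<Rightarrow> bool" and L :: "'a \<Rightarrow> 'c set"
  assumes "finite V" and bipartite: "\<And>v u. u \<in> N v \<Longrightarrow> side u \<noteq> side v"
    and "\<And>v. v \<in> V \<Longrightarrow> finite (L v) \<and> card (N v \<inter> V) < card (L v)"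
  shows "\<exists>c. (\<forall>v\<in>V. c v \<in> L v) \<and> (\<forall>v\<in>V. \<forall>u\<in>N v \<inter> V. c v \<noteq> c u)"
  using assms(1,3)
proof (induction V arbitrary: L rule: finite_psubset_induct)
  case (psubset V)
  show ?case
  proof (cases "V = {}")
    case False
    then obtain w where w: "w \<in> V" by blast
    with psubset.prems have "L w \<noteq> {}" by fastforce
    then obtain a where a: "a \<in> L w" by blast
    define W where "W = {v \<in> V. a \<in> L v}"
    have "finite W" using psubset.hyps by (simp add: W_def)
    from bipartite_kernel_exists[where N = N and side = side, OF this bipartite] obtain K where K: "K \<subseteq> W"
      "\<forall>v\<in>K. N v \<inter> K = {}" "\<forall>v\<in>W - K. N v \<inter> K \<noteq> {}" by blast
    \<comment> \<open>\<open>w\<close> lies in \<open>W\<close>, and an empty kernel could not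
      dominate it, so the induction makes progress.\<close>
    have "K \<noteq> {}" using K(3) w a by (auto simp: W_def)
    then have sub: "V - K \<subset> V" using K(1) by (auto simp: W_def)
    have lists: "finite (L v - {a}) \<and> card (N v \<inter> (V - K)) < card (L v - {a})" if v: "v \<in> V - K" for v
    proof -
      have L: "finite (L v)" "card (N v \<inter> V) < card (L v)" using psubset.prems v by auto
      have fin: "finite (N v \<inter> V)" using psubset.hyps by simp
      show ?thesis
      proof (cases "a \<in> L v")
        case True
        then have "N v \<inter> K \<noteq> {}" using K(3) v by (simp add: W_def)
        then have "N v \<inter> (V - K) \<subset> N v \<inter> V" using K(1) by (auto simp: W_def)
        then have "card (N v \<inter> (V - K)) < card (N v \<inter> V)" by (rule psubset_card_mono[OF fin])
        with L True show ?thesis by simp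
      next
        case False
        have "card (N v \<inter> (V - K)) \<le> card (N v \<inter> V)" using fin by (intro card_mono) auto
        with L False show ?thesis by simp
      qed
    qed
    from psubset.IH[OF sub lists] obtain c where c: "\<forall>v\<in>V - K. c v \<in> L v - {a}"
      "\<forall>v\<in>V - K. \<forall>u\<in>N v \<inter> (V - K). c v \<noteq> c u" by blast
    \<comment> \<open>Arcs inside \<open>K\<close> do not exist, and arcs between \<open>K\<close>
      and its complement are safe because \<open>c\<close> avoids \<open>a\<close> there.\<close>
    let ?c = "\<lambda>v. if v \<in> K then a else c v"
    have "\<forall>v\<in>V. ?c v \<in> L v" using c(1) K(1) by (auto simp: W_def)
    moreover have "?c v \<noteq> ?c u" if "v \<in> V" "u \<in> N v \<inter> V" for v u
      using that c K(2) by (cases "v \<in> K"; cases "u \<in> K") auto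
    ultimately show ?thesis by (intro exI[of _ ?c]) blast
  qed simp
qed

theorem theorem5:
  fixes V :: "'a set" and E :: "'a set set" and \<phi> :: "'a set \<Rightarrow> 'a"
  assumes "hypergraph V E"
    and "colorable 2 V E"
    and "orientation E \<phi>"
  shows "choosable TYPE('c) V E (\<lambda>v. orient_deg E \<phi> v + 1)"
  unfolding choosable_def
proof (intro allI impI)
  fix L :: "'a \<Rightarrow> 'c set"
  assume L: "\<forall>v\<in>V. finite (L v) \<and> card (L v) = orient_deg E \<phi> v + 1"
  have V: "finite V" "E \<subseteq> Pow V" using assms(1) by (auto simp: hypergraph_def)
  then have "finite E" by (meson finite_Pow_iff finite_subset)
  from assms(2) obtain b where b: "b \<in> V \<rightarrow> {..<2::nat}" "proper_coloring E b"
    by (auto simp: colorable_def)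
  define side where "side v \<longleftrightarrow> b v = 0" for v
  have "\<exists>x\<in>e. side x \<noteq> side (\<phi> e)" if e: "e \<in> E" for e
  proof -
    obtain x y where xy: "x \<in> e" "y \<in> e" "b x \<noteq> b y"
      using b(2) e by (auto simp: proper_coloring_def)
    have "b x < 2" "b y < 2" using b(1) V(2) e xy by (auto simp: Pi_iff)
    then have "side x \<noteq> side y" using xy(3) by (auto simp: side_def)
    \<comment> \<open>As \<open>x\<close> and \<open>y\<close> lie on different sides, one of them
      is opposite to \<open>\<phi> e\<close>.\<close>
    then show ?thesis using xy by blast
  qed
  then obtain \<psi> where \<psi>: "\<And>e. e \<in> E \<Longrightarrow> \<psi> e \<in> e \<and> side (\<psi> e) \<noteq> side (\<phi> e)" by metis
  define N where "N v = \<psi> ` {e \<in> E. \<phi> e = v}" for v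
  have "side u \<noteq> side v" if "u \<in> N v" for u v
    using that \<psi> by (auto simp: N_def)
  moreover have "finite (L v) \<and> card (N v \<inter> V) < card (L v)" if "v \<in> V" for v
  proof -
    have fin: "finite {e \<in> E. \<phi> e = v}" using \<open>finite E\<close> by simp
    have "card (N v \<inter> V) \<le> card (N v)" using fin by (intro card_mono) (auto simp: N_def)
    \<comment> \<open>Edges oriented to \<open>v\<close> may share their value of
      \<open>\<psi>\<close>, hence only an inequality; the \<open>+ 1\<close> in the list size then
      makes the bound strict.\<close>
    also have "\<dots> \<le> orient_deg E \<phi> v"
      unfolding N_def orient_deg_def using fin by (rule card_image_le)
    finally show ?thesis using L that by simp
  qed
  ultimately obtain c where c: "\<forall>v\<in>V. c v \<in> L v" "\<forall>v\<in>V. \<forall>u\<in>N v \<inter> V. c v \<noteq> c u"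
    using bipartite_digraph_list_coloring[OF V(1), of N side L] by blast
  have "\<exists>x\<in>e. \<exists>y\<in>e. c x \<noteq> c y" if e: "e \<in> E" for e
  proof -
    have "\<phi> e \<in> e" "\<psi> e \<in> e" using assms(3) \<psi> e by (auto simp: orientation_def)
    moreover have "\<psi> e \<in> N (\<phi> e)" using e by (auto simp: N_def)
    ultimately show ?thesis using c(2) V(2) e by blast
  qed
  then show "\<exists>c. (\<forall>v\<in>V. c v \<in> L v) \<and> proper_coloring E c"
    using c(1) by (auto simp: proper_coloring_def)
qed

end
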